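(* Let $T$ be a compact torus and let $f,g:X\to X'$ be two continuous $T$-equivariant maps between topological $T$-spaces which are homotopic to each other through $T$-equivariant maps. Then $f^*=g^*:\mathcal{A}_T(X')\to\mathcal{A}_T(X)$.
   Context: $T$ is a compact torus with Lie algebra $\mathfrak{t}$; a $T$-space is a topological space $X$ with a continuous $T$-action. For $p\in X$, $T_p$ is the isotropy group and $\mathfrak{t}_p\subset\mathfrak{t}$ its Lie algebra; for a subspace $\mathfrak{h}\subset\mathfrak{t}$, $S(\mathfrak{h}^* )$ is the algebra of real polynomial functions on $\mathfrak{h}$. A (polynomial) assignment on $X$ is a map $A$ assigning to each $p\in X$ a polynomial $A(p)\in S(\mathfrak{t}_p^* )$ such that for every (connected) subtorus $H\subset T$ with Lie algebra $\mathfrak{h}$, the map $A^{\mathfrak{h}}:X^H\to S(\mathfrak{h}^* )$, $A^{\mathfrak{h}}(p):=A(p)|_{\mathfrak{h}}$, is locally constant on the fixed point set $X^H$. $\mathcal{A}_T(X)$ denotes the set of all assignments; it is an $S(\mathfrak{t}^* )$-algebra with pointwise operations, $(fA)(p)=f|_{\mathfrak{t}_p}A(p)$ for $f\in S(\mathfrak{t}^* )$. A continuous $T$-equivariant map $f:X\to X'$ induces the $S(\mathfrak{t}^* )$-algebra homomorphism $f^*:\mathcal{A}_T(X')\to\mathcal{A}_T(X)$, $f^*(A)(p):=A(f(p))|_{\mathfrak{t}_p}$.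
   Formalization: The isotropy groups of X are assumed closed in T (automatic if points of X are closed), so that their Lie algebras make sense; without this the claim fails, e.g. for X = T²/L with L an irrational line, X' = X×[0,1] and f, g the two ends. *)

theory Defs
  imports "HOL-Analysis.Analysis" "HOL-Algebra.Group_Action"
begin

text \<open>
  A compact torus is presented as the quotient of its Lie algebra by a full lattice: \<open>T\<close> is the
  abstract group, \<open>\<tau>\<close> its topology, \<open>\<tt>\<close> the Lie algebra (a subspace of some Euclidean space, so
  that every rank, including 0, occurs) and \<open>e\<close> the exponential map, whose kernel is the integral
  lattice. Via coordinates with respect to the lattice basis \<open>B\<close> this says exactly that \<open>T\<close> is
  isomorphic, as a topological group, to a power of the circle group; in particular multiplication
  and inversion are continuous and \<open>\<tau>\<close> is compact and Hausdorff.
\<close>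

locale compact_torus = comm_group T
  for T :: "('g, 'm) monoid_scheme" (structure) +
  fixes \<tau> :: "'g topology"
    and \<tt> :: "'v::euclidean_space set"
    and e :: "'v \<Rightarrow> 'g"
  assumes topspace_eq: "topspace \<tau> = carrier T"
    and subspace_lie: "subspace \<tt>"
    and exp_add: "\<lbrakk>x \<in> \<tt>; y \<in> \<tt>\<rbrakk> \<Longrightarrow> e (x + y) = e x \<otimes> e y"
    and exp_quotient: "quotient_map (top_of_set \<tt>) \<tau> e"
    and exp_kernel: "\<exists>B. independent B \<and> span B = \<tt> \<and>
          {x \<in> \<tt>. e x = \<one>} = range (\<lambda>k::'v \<Rightarrow> int. \<Sum>b\<in>B. of_int (k b) *\<^sub>R b)"

text \<open>The subtori of a compact torus are its closed connected subgroups.\<close>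

definition subtorus :: "('g, 'm) monoid_scheme \<Rightarrow> 'g topology \<Rightarrow> 'g set \<Rightarrow> bool" where
  "subtorus T \<tau> H \<longleftrightarrow> subgroup H T \<and> closedin \<tau> H \<and> connectedin \<tau> H"

definition lie_algebra :: "'v::euclidean_space set \<Rightarrow> ('v \<Rightarrow> 'g) \<Rightarrow> 'g set \<Rightarrow> 'v set" where
  "lie_algebra \<tt> e K = {\<xi> \<in> \<tt>. \<forall>s::real. e (s *\<^sub>R \<xi>) \<in> K}"

text \<open>
  The polynomial functions on a subspace are the restrictions of those on the ambient space.
  Functions on a subspace are represented extensionally (\<open>undefined\<close> outside), so that equality
  of functions is equality on the subspace.
\<close>

definition polynomials_on :: "'v::euclidean_space set \<Rightarrow> ('v \<Rightarrow> real) set" where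
  "polynomials_on \<hh> = {restrict q \<hh> | q. real_polynomial_function q}"

definition T_space ::
  "('g, 'm) monoid_scheme \<Rightarrow> 'g topology \<Rightarrow> 'a topology \<Rightarrow> ('g \<Rightarrow> 'a \<Rightarrow> 'a) \<Rightarrow> bool" where
  "T_space T \<tau> X \<phi> \<longleftrightarrow> group_action T (topspace X) \<phi> \<and>
     continuous_map (prod_topology \<tau> X) X (\<lambda>(g, x). \<phi> g x)"

definition equivariant ::
  "('g, 'm) monoid_scheme \<Rightarrow> 'a topology \<Rightarrow> ('g \<Rightarrow> 'a \<Rightarrow> 'a) \<Rightarrow> ('g \<Rightarrow> 'b \<Rightarrow> 'b) \<Rightarrow> ('a \<Rightarrow> 'b) \<Rightarrow> bool"
  where
  "equivariant T X \<phi> \<phi>' f \<longleftrightarrow> (\<forall>g\<in>carrier T. \<forall>x\<in>topspace X. f (\<phi> g x) = \<phi>' g (f x))"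

definition fixed_points :: "'a topology \<Rightarrow> ('g \<Rightarrow> 'a \<Rightarrow> 'a) \<Rightarrow> 'g set \<Rightarrow> 'a set" where
  "fixed_points X \<phi> H = {x \<in> topspace X. \<forall>g\<in>H. \<phi> g x = x}"

definition isotropy_algebra ::
  "('g, 'm) monoid_scheme \<Rightarrow> 'v::euclidean_space set \<Rightarrow> ('v \<Rightarrow> 'g) \<Rightarrow> ('g \<Rightarrow> 'a \<Rightarrow> 'a) \<Rightarrow> 'a \<Rightarrow> 'v set"
  where
  "isotropy_algebra T \<tt> e \<phi> p = lie_algebra \<tt> e (stabilizer T \<phi> p)"

definition locally_constant_on :: "'a topology \<Rightarrow> 'a set \<Rightarrow> ('a \<Rightarrow> 'c) \<Rightarrow> bool" where
  "locally_constant_on X S F \<longleftrightarrow>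
     (\<forall>p\<in>S. \<exists>U. openin (subtopology X S) U \<and> p \<in> U \<and> (\<forall>q\<in>U. F q = F p))"

definition assignments ::
  "('g, 'm) monoid_scheme \<Rightarrow> 'g topology \<Rightarrow> 'v::euclidean_space set \<Rightarrow> ('v \<Rightarrow> 'g) \<Rightarrow>
   'a topology \<Rightarrow> ('g \<Rightarrow> 'a \<Rightarrow> 'a) \<Rightarrow> ('a \<Rightarrow> 'v \<Rightarrow> real) set" where
  "assignments T \<tau> \<tt> e X \<phi> =
     {A \<in> (\<Pi>\<^sub>E p\<in>topspace X. polynomials_on (isotropy_algebra T \<tt> e \<phi> p)).
       \<forall>H. subtorus T \<tau> H \<longrightarrow>
         locally_constant_on X (fixed_points X \<phi> H) (\<lambda>p. restrict (A p) (lie_algebra \<tt> e H))}"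

text \<open>The map \<open>f\<^sup>*\<close> induced by a continuous equivariant \<open>f\<close> from \<open>(X, \<phi>)\<close> to another space.\<close>

definition pullback ::
  "('g, 'm) monoid_scheme \<Rightarrow> 'v::euclidean_space set \<Rightarrow> ('v \<Rightarrow> 'g) \<Rightarrow>
   'a topology \<Rightarrow> ('g \<Rightarrow> 'a \<Rightarrow> 'a) \<Rightarrow> ('a \<Rightarrow> 'b) \<Rightarrow> ('b \<Rightarrow> 'v \<Rightarrow> real) \<Rightarrow> ('a \<Rightarrow> 'v \<Rightarrow> real)" where
  "pullback T \<tt> e X \<phi> f A =
     (\<lambda>p\<in>topspace X. restrict (A (f p)) (isotropy_algebra T \<tt> e \<phi> p))"

text \<open>
  The Lie algebra of an isotropy group only makes sense as that of a closed subgroup. Isotropy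
  groups are closed as soon as points are closed, in particular in Hausdorff spaces.
\<close>

definition closed_isotropy ::
  "('g, 'm) monoid_scheme \<Rightarrow> 'g topology \<Rightarrow> 'a topology \<Rightarrow> ('g \<Rightarrow> 'a \<Rightarrow> 'a) \<Rightarrow> bool" where
  "closed_isotropy T \<tau> X \<phi> \<longleftrightarrow> (\<forall>p\<in>topspace X. closedin \<tau> (stabilizer T \<phi> p))"

lemma closed_isotropy_if_t1_space:
  assumes "topspace \<tau> = carrier T" "T_space T \<tau> X \<phi>" "t1_space X"
  shows "closed_isotropy T \<tau> X \<phi>"
  unfolding closed_isotropy_def
proof
  fix p assume p: "p \<in> topspace X"
  have "continuous_map \<tau> (prod_topology \<tau> X) (\<lambda>g. (g, p))"
    using p by (simp add: continuous_map_pairedI)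
  then have "continuous_map \<tau> X ((\<lambda>(g, x). \<phi> g x) \<circ> (\<lambda>g. (g, p)))"
    using assms(2) continuous_map_compose unfolding T_space_def by blast
  moreover have "closedin X {p}"
    using assms(3) p by (simp add: t1_space_closedin_singleton)
  ultimately have "closedin \<tau> {g \<in> topspace \<tau>. ((\<lambda>(g, x). \<phi> g x) \<circ> (\<lambda>g. (g, p))) g \<in> {p}}"
    by (rule closedin_continuous_map_preimage)
  then show "closedin \<tau> (stabilizer T \<phi> p)"
    by (simp add: stabilizer_def assms(1))
qed

lemma isotropy_algebra_mono:
  assumes "equivariant T X \<phi> \<phi>' f" "p \<in> topspace X"
  shows "isotropy_algebra T \<tt> e \<phi> p \<subseteq> isotropy_algebra T \<tt> e \<phi>' (f p)"
proof -
  have "stabilizer T \<phi> p \<subseteq> stabilizer T \<phi>' (f p)"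
    using assms unfolding equivariant_def stabilizer_def by force
  then show ?thesis
    unfolding isotropy_algebra_def lie_algebra_def by blast
qed

lemma pullback_in_assignments:
  assumes cont: "continuous_map X X' f" and eqv: "equivariant T X \<phi> \<phi>' f"
    and A: "A \<in> assignments T \<tau> \<tt> e X' \<phi>'"
  shows "pullback T \<tt> e X \<phi> f A \<in> assignments T \<tau> \<tt> e X \<phi>"
proof -
  let ?F = "pullback T \<tt> e X \<phi> f A"
  have f: "f p \<in> topspace X'" if "p \<in> topspace X" for p
    using cont that by (auto simp: continuous_map_def)
  have pol: "?F p \<in> polynomials_on (isotropy_algebra T \<tt> e \<phi> p)" if p: "p \<in> topspace X" for p
  proof -
    have "A (f p) \<in> polynomials_on (isotropy_algebra T \<tt> e \<phi>' (f p))"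
      using A f[OF p] by (auto simp: assignments_def)
    then obtain q where q: "real_polynomial_function q"
      "A (f p) = restrict q (isotropy_algebra T \<tt> e \<phi>' (f p))"
      by (auto simp: polynomials_on_def)
    have "?F p = restrict q (isotropy_algebra T \<tt> e \<phi> p)"
      using isotropy_algebra_mono[OF eqv p, of \<tt> e] p
      by (simp add: pullback_def q(2) Int_absorb1)
    then show ?thesis
      using q(1) by (auto simp: polynomials_on_def)
  qed
  have loc: "locally_constant_on X (fixed_points X \<phi> H)
               (\<lambda>p. restrict (?F p) (lie_algebra \<tt> e H))" if H: "subtorus T \<tau> H" for H
    unfolding locally_constant_on_def
  proof
    fix p assume p: "p \<in> fixed_points X \<phi> H"
    have HT: "H \<subseteq> carrier T"
      using H subgroup.subset unfolding subtorus_def by blast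
    have fixf: "f x \<in> fixed_points X' \<phi>' H" if "x \<in> fixed_points X \<phi> H" for x
      using that eqv HT f unfolding fixed_points_def equivariant_def by force
    have res: "restrict (?F x) (lie_algebra \<tt> e H) = restrict (A (f x)) (lie_algebra \<tt> e H)"
      if x: "x \<in> fixed_points X \<phi> H" for x
    proof -
      have "lie_algebra \<tt> e H \<subseteq> isotropy_algebra T \<tt> e \<phi> x"
        using x HT unfolding isotropy_algebra_def lie_algebra_def stabilizer_def fixed_points_def
        by blast
      then show ?thesis
        using x by (simp add: pullback_def fixed_points_def Int_absorb1)
    qed
    have "locally_constant_on X' (fixed_points X' \<phi>' H) (\<lambda>y. restrict (A y) (lie_algebra \<tt> e H))"
      using A H by (simp add: assignments_def)
    then obtain U where U: "openin (subtopology X' (fixed_points X' \<phi>' H)) U" "f p \<in> U"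
      "\<And>y. y \<in> U \<Longrightarrow> restrict (A y) (lie_algebra \<tt> e H) = restrict (A (f p)) (lie_algebra \<tt> e H)"
      unfolding locally_constant_on_def using fixf[OF p] by meson
    have "continuous_map (subtopology X (fixed_points X \<phi> H))
            (subtopology X' (fixed_points X' \<phi>' H)) f"
      by (simp add: continuous_map_in_subtopology continuous_map_from_subtopology cont)
         (use fixf in blast)
    then have "openin (subtopology X (fixed_points X \<phi> H))
        {x \<in> topspace (subtopology X (fixed_points X \<phi> H)). f x \<in> U}" (is "openin _ ?V")
      using U(1) by (rule openin_continuous_map_preimage)
    moreover have "p \<in> ?V"
      using p U(2) by (simp add: fixed_points_def)
    moreover have "restrict (?F x) (lie_algebra \<tt> e H) = restrict (?F p) (lie_algebra \<tt> e H)"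
      if "x \<in> ?V" for x
    proof -
      have "x \<in> fixed_points X \<phi> H" "f x \<in> U"
        using that by auto
      then show ?thesis
        using res[of x] res[OF p] U(3)[of "f x"] by simp
    qed
    ultimately show "\<exists>V. openin (subtopology X (fixed_points X \<phi> H)) V \<and> p \<in> V \<and>
        (\<forall>x\<in>V. restrict (?F x) (lie_algebra \<tt> e H) = restrict (?F p) (lie_algebra \<tt> e H))"
      by (intro exI[of _ ?V] conjI ballI)
  qed
  have "?F \<in> extensional (topspace X)"
    by (simp add: pullback_def)
  then show ?thesis
    unfolding assignments_def using pol loc by (auto simp: PiE_iff)
qed

end

theory Submission
  imports Defs
begin

text \<open>
  Fix \<open>p\<close> in \<open>X\<close> with isotropy group \<open>K\<close>, and let \<open>H\<close> be the identity component of \<open>K\<close>. As \<open>K\<close> is a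
  closed subgroup, \<open>H\<close> is a subtorus (\<open>subtorus_identity_component\<close>), and it has the same Lie
  algebra as \<open>K\<close>, because every one-parameter subgroup of \<open>K\<close> is connected and hence stays in \<open>H\<close>
  (\<open>lie_algebra_identity_component\<close>). Every map of an equivariant homotopy sends \<open>p\<close> to a point
  fixed by \<open>H\<close>, so the track of \<open>p\<close> is a connected subset of the fixed point set of \<open>H\<close> that joins
  \<open>f p\<close> to \<open>g p\<close>. An assignment \<open>A\<close>, restricted to the Lie algebra of \<open>H\<close>, is locally constant on
  that fixed point set, hence constant along the track. Therefore \<open>A (f p)\<close> and \<open>A (g p)\<close> agree on
  the Lie algebra of \<open>H\<close>, which is the isotropy algebra of \<open>p\<close>, and this is the domain on which both
  pullbacks are evaluated at \<open>p\<close>.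
\<close>

lemma locally_constant_on_connectedin:
  assumes F: "locally_constant_on X S F" and C: "connectedin (subtopology X S) C"
    and a: "a \<in> C" and b: "b \<in> C"
  shows "F a = F b"
proof (rule ccontr)
  assume ne: "F a \<noteq> F b"
  \<comment> \<open>Each set defined by a condition on the value of \<open>F\<close> is open, so the points of \<open>C\<close> where \<open>F\<close>
    equals \<open>F a\<close> and those where it does not would separate \<open>C\<close>.\<close>
  have level_open: "openin (subtopology X S) {x \<in> topspace (subtopology X S). Q (F x)}" for Q
  proof (rule iffD2[OF openin_subopen], intro ballI)
    fix x assume x: "x \<in> {x \<in> topspace (subtopology X S). Q (F x)}"
    then have "x \<in> S" by simp
    with F obtain U where U: "openin (subtopology X S) U" "x \<in> U" "\<forall>y\<in>U. F y = F x"
      unfolding locally_constant_on_def by blast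
    have "Q (F y)" if "y \<in> U" for y
      using x bspec[OF U(3) that] by simp
    then have "U \<subseteq> {x \<in> topspace (subtopology X S). Q (F x)}"
      using openin_subset[OF U(1)] by blast
    with U show "\<exists>U. openin (subtopology X S) U \<and> x \<in> U \<and>
        U \<subseteq> {x \<in> topspace (subtopology X S). Q (F x)}"
      by blast
  qed
  define U where "U = {x \<in> topspace (subtopology X S). F x = F a}"
  define V where "V = {x \<in> topspace (subtopology X S). F x \<noteq> F a}"
  have "openin (subtopology X S) U" "openin (subtopology X S) V"
    unfolding U_def V_def by (rule level_open)+
  moreover have "C \<subseteq> topspace (subtopology X S)"
    using C connectedin_subset_topspace by blast
  then have "C \<subseteq> U \<union> V" "U \<inter> V \<inter> C = {}" "U \<inter> C \<noteq> {}" "V \<inter> C \<noteq> {}"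
    using a b ne unfolding U_def V_def by auto
  ultimately show False
    using C unfolding connectedin by blast
qed

context compact_torus
begin

lemma exp_image: "e ` \<tt> = carrier T"
  using exp_quotient topspace_eq by (auto simp: quotient_map_def)

lemma exp_zero: "e 0 = \<one>"
proof -
  have "0 \<in> \<tt>"
    using subspace_lie subspace_0 by blast
  then have "e 0 \<in> carrier T" "e 0 = e 0 \<otimes> e 0"
    using exp_image exp_add[of 0 0] by auto
  then show ?thesis
    using r_cancel_one'[of "e 0" "e 0"] by blast
qed

text \<open>A translation of the group lifts along the quotient map \<open>e\<close> to a translation of \<open>\<tt>\<close>.\<close>

lemma continuous_map_translation:
  assumes "a \<in> carrier T"
  shows "continuous_map \<tau> \<tau> (\<lambda>g. a \<otimes> g)"
proof -
  obtain x where x: "x \<in> \<tt>" "a = e x"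
    using assms exp_image by blast
  have "continuous_map (top_of_set \<tt>) (top_of_set \<tt>) (\<lambda>y. x + y)"
    using x subspace_lie by (auto intro!: continuous_intros simp: subspace_add)
  moreover have "continuous_map (top_of_set \<tt>) \<tau> e"
    using exp_quotient quotient_imp_continuous_map by blast
  ultimately have "continuous_map (top_of_set \<tt>) \<tau> (e \<circ> (\<lambda>y. x + y))"
    by (rule continuous_map_compose)
  then have "continuous_map (top_of_set \<tt>) \<tau> ((\<lambda>g. a \<otimes> g) \<circ> e)"
    by (rule continuous_map_eq) (use x exp_add in auto)
  then show ?thesis
    using exp_quotient continuous_compose_quotient_map_eq by blast
qed

definition identity_component :: "'g set \<Rightarrow> 'g set" where
  "identity_component K = connected_component_of_set (subtopology \<tau> K) \<one>"

lemma identity_component_subset: "identity_component K \<subseteq> K"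
  using connected_component_of_subset_topspace[of "subtopology \<tau> K" \<one>]
  by (auto simp: identity_component_def)

lemma identity_component_maximal:
  assumes "connectedin \<tau> C" "C \<subseteq> K" "\<one> \<in> C"
  shows "C \<subseteq> identity_component K"
  unfolding identity_component_def
  using assms by (intro connected_component_of_maximal) (auto simp: connectedin_subtopology)

text \<open>
  For \<open>a\<close> in the identity component \<open>C\<close>, the translate of \<open>C\<close> by the inverse of \<open>a\<close> is connected and
  contains \<open>\<one>\<close>, so it lies in \<open>C\<close>. This alone gives closure under inverses, by translating \<open>\<one>\<close>, and
  then closure under products, by translating with the inverse of the inverse.
\<close>

lemma subtorus_identity_component:
  assumes K: "subgroup K T" and closed: "closedin \<tau> K"
  shows "subtorus T \<tau> (identity_component K)"
proof -
  let ?C = "identity_component K"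
  have KT: "K \<subseteq> carrier T" and one: "\<one> \<in> K"
    using K by (auto simp: subgroup.subset subgroup.one_closed)
  have one_K: "\<one> \<in> topspace (subtopology \<tau> K)"
    using one KT topspace_eq by auto
  then have one_C: "\<one> \<in> ?C"
    by (simp add: identity_component_def connected_component_of_refl)
  have conn: "connectedin \<tau> ?C"
    using connectedin_connected_component_of[of "subtopology \<tau> K" \<one>]
    by (simp add: identity_component_def connectedin_subtopology)
  have "closedin (subtopology \<tau> K) ?C"
    unfolding identity_component_def by (rule closedin_connected_component_of)
  then have clo: "closedin \<tau> ?C"
    using closed closedin_trans_full by blast
  have CK: "a \<in> K" "a \<in> carrier T" if "a \<in> ?C" for a
    using that identity_component_subset KT by auto
  have translate: "inv a \<otimes> b \<in> ?C" if a: "a \<in> ?C" and b: "b \<in> ?C" for a b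
  proof -
    have "(\<lambda>g. inv a \<otimes> g) ` ?C \<subseteq> ?C"
    proof (rule identity_component_maximal)
      show "connectedin \<tau> ((\<lambda>g. inv a \<otimes> g) ` ?C)"
        using CK(2)[OF a] conn
        by (intro connectedin_continuous_map_image[OF continuous_map_translation]) auto
      show "(\<lambda>g. inv a \<otimes> g) ` ?C \<subseteq> K"
        using CK a K by (auto intro: subgroup.m_closed subgroup.m_inv_closed)
      show "\<one> \<in> (\<lambda>g. inv a \<otimes> g) ` ?C"
        using CK(2)[OF a] a by (metis imageI l_inv)
    qed
    with b show ?thesis by blast
  qed
  have inv: "inv a \<in> ?C" if a: "a \<in> ?C" for a
    using translate[OF a one_C] CK(2)[OF a] by simp
  have "subgroup ?C T"
  proof (rule subgroupI)
    show "?C \<subseteq> carrier T" "?C \<noteq> {}"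
      using CK one_C by auto
    show "inv a \<in> ?C" if "a \<in> ?C" for a
      using that by (rule inv)
    show "a \<otimes> b \<in> ?C" if "a \<in> ?C" "b \<in> ?C" for a b
      using translate[OF inv[OF that(1)] that(2)] CK(2)[OF that(1)] by simp
  qed
  with conn clo show ?thesis
    by (simp add: subtorus_def)
qed

lemma lie_algebra_identity_component:
  "lie_algebra \<tt> e (identity_component K) = lie_algebra \<tt> e K"
proof
  show "lie_algebra \<tt> e (identity_component K) \<subseteq> lie_algebra \<tt> e K"
    using identity_component_subset unfolding lie_algebra_def by blast
  show "lie_algebra \<tt> e K \<subseteq> lie_algebra \<tt> e (identity_component K)"
  proof
    fix \<xi> assume \<xi>: "\<xi> \<in> lie_algebra \<tt> e K"
    then have \<xi>_t: "s *\<^sub>R \<xi> \<in> \<tt>" for s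
      using subspace_lie by (auto simp: lie_algebra_def subspace_scale)
    have "continuous_map euclideanreal (top_of_set \<tt>) (\<lambda>s. s *\<^sub>R \<xi>)"
      using \<xi>_t by (auto simp: continuous_map_in_subtopology intro!: continuous_intros)
    then have "continuous_map euclideanreal \<tau> (e \<circ> (\<lambda>s. s *\<^sub>R \<xi>))"
      using exp_quotient quotient_imp_continuous_map continuous_map_compose by blast
    then have "connectedin \<tau> ((e \<circ> (\<lambda>s. s *\<^sub>R \<xi>)) ` UNIV)"
      by (rule connectedin_continuous_map_image) simp
    moreover have "(e \<circ> (\<lambda>s. s *\<^sub>R \<xi>)) ` UNIV \<subseteq> K"
      using \<xi> by (auto simp: lie_algebra_def)
    moreover have "\<one> \<in> (e \<circ> (\<lambda>s. s *\<^sub>R \<xi>)) ` UNIV"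
      using exp_zero by (intro image_eqI[of _ _ 0]) auto
    ultimately have "(e \<circ> (\<lambda>s. s *\<^sub>R \<xi>)) ` UNIV \<subseteq> identity_component K"
      by (rule identity_component_maximal)
    with \<xi> show "\<xi> \<in> lie_algebra \<tt> e (identity_component K)"
      by (auto simp: lie_algebra_def)
  qed
qed

end

theorem proposition2p7:
  fixes T :: "('g, 'm) monoid_scheme" and \<tau> :: "'g topology"
    and \<tt> :: "'v::euclidean_space set" and e :: "'v \<Rightarrow> 'g"
    and X :: "'a topology" and \<phi> :: "'g \<Rightarrow> 'a \<Rightarrow> 'a"
    and X' :: "'b topology" and \<phi>' :: "'g \<Rightarrow> 'b \<Rightarrow> 'b"
    and f g :: "'a \<Rightarrow> 'b"
  assumes torus: "compact_torus T \<tau> \<tt> e"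
    and X: "T_space T \<tau> X \<phi>" and X_closed: "closed_isotropy T \<tau> X \<phi>"
    and X': "T_space T \<tau> X' \<phi>'"
    and f: "continuous_map X X' f" "equivariant T X \<phi> \<phi>' f"
    and g: "continuous_map X X' g" "equivariant T X \<phi> \<phi>' g"
    and homotopic: "homotopic_with (equivariant T X \<phi> \<phi>') X X' f g"
  shows "restrict (pullback T \<tt> e X \<phi> f) (assignments T \<tau> \<tt> e X' \<phi>') =
         restrict (pullback T \<tt> e X \<phi> g) (assignments T \<tau> \<tt> e X' \<phi>')"
proof -
  interpret compact_torus T \<tau> \<tt> e
    by (rule torus)
  interpret action: group_action T "topspace X" \<phi>
    using X by (simp add: T_space_def)
  obtain h where h: "continuous_map (prod_topology (top_of_set {0..1::real}) X) X' h"
    "\<And>x. h (0, x) = f x" "\<And>x. h (1, x) = g x"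
    "\<And>t. t \<in> {0..1} \<Longrightarrow> equivariant T X \<phi> \<phi>' (\<lambda>x. h (t, x))"
    using homotopic unfolding homotopic_with_def by blast
  have "restrict (A (f p)) (isotropy_algebra T \<tt> e \<phi> p) =
        restrict (A (g p)) (isotropy_algebra T \<tt> e \<phi> p)"
    if A: "A \<in> assignments T \<tau> \<tt> e X' \<phi>'" and p: "p \<in> topspace X" for A p
  proof -
    define K where "K = stabilizer T \<phi> p"
    define H where "H = identity_component K"
    define track where "track = (\<lambda>t. h (t, p)) ` {0..1}"
    have "subtorus T \<tau> H"
      unfolding H_def K_def
      using action.stabilizer_subgroup[OF p] X_closed p
      by (intro subtorus_identity_component) (auto simp: closed_isotropy_def)
    then have loc: "locally_constant_on X' (fixed_points X' \<phi>' H)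
        (\<lambda>y. restrict (A y) (lie_algebra \<tt> e H))"
      using A by (simp add: assignments_def)
    have "continuous_map (top_of_set {0..1}) (prod_topology (top_of_set {0..1::real}) X) (\<lambda>t. (t, p))"
      using p by (simp add: continuous_map_pairedI)
    then have "continuous_map (top_of_set {0..1}) X' (h \<circ> (\<lambda>t. (t, p)))"
      using h(1) continuous_map_compose by blast
    then have "connectedin X' ((h \<circ> (\<lambda>t. (t, p))) ` {0..1})"
      by (rule connectedin_continuous_map_image) (simp add: connectedin_subtopology)
    then have conn: "connectedin X' track"
      by (simp add: track_def comp_def)
    have "track \<subseteq> fixed_points X' \<phi>' H"
    proof
      fix y assume y: "y \<in> track"
      then obtain t where t: "t \<in> {0..1}" "y = h (t, p)"
        by (auto simp: track_def)
      have "\<phi>' k y = y" if "k \<in> H" for k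
      proof -
        have "k \<in> carrier T" "\<phi> k p = p"
          using that identity_component_subset[of K] by (auto simp: H_def K_def stabilizer_def)
        then show ?thesis
          using h(4)[OF t(1)] p t(2) unfolding equivariant_def by metis
      qed
      moreover have "y \<in> topspace X'"
        using conn y connectedin_subset_topspace by blast
      ultimately show "y \<in> fixed_points X' \<phi>' H"
        by (simp add: fixed_points_def)
    qed
    with conn have "connectedin (subtopology X' (fixed_points X' \<phi>' H)) track"
      by (simp add: connectedin_subtopology)
    moreover have "f p \<in> track" "g p \<in> track"
      unfolding track_def h(2)[symmetric] h(3)[symmetric] by auto
    ultimately have "restrict (A (f p)) (lie_algebra \<tt> e H) = restrict (A (g p)) (lie_algebra \<tt> e H)"
      by (rule locally_constant_on_connectedin[OF loc])
    then show ?thesis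
      by (simp add: H_def K_def lie_algebra_identity_component isotropy_algebra_def)
  qed
  then have "pullback T \<tt> e X \<phi> f A = pullback T \<tt> e X \<phi> g A"
    if "A \<in> assignments T \<tau> \<tt> e X' \<phi>'" for A
    unfolding pullback_def using that by (intro restrict_cong) simp_all
  then show ?thesis
    by (intro restrict_cong) simp_all
qed

end
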